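(* Let $\mathbf p\in\mathbb Z^2\setminus\{0\}$, $\Gamma\in\mathbb C\setminus\{0\}$, and let $L$ be the associated linearized 2D Euler operator on $\ell^2(\mathbb Z^2)$. Let $\varkappa$ be the number of points $\mathbf q\in\mathbb Z^2$ with $\|\mathbf q\|<\|\mathbf p\|$ and $\mathbf q\ne t\mathbf p$ for all $t\in\mathbb R$. Then the number of nonimaginary eigenvalues of $L$ (i.e. eigenvalues in $\mathbb C\setminus i\mathbb R$), counting multiplicities, does not exceed $2\varkappa$.
   Context: Notation: $\|\cdot\|$ is the Euclidean norm on $\mathbb R^2$. For $\mathbf a=(a_1,a_2),\mathbf b=(b_1,b_2)\in\mathbb Z^2$ set $$A(\mathbf a,\mathbf b)=\frac12\left[\frac1{\|\mathbf a\|^2}-\frac1{\|\mathbf b\|^2}\right](a_1b_2-a_2b_1)\quad\text{if }\mathbf a\ne\pm\mathbf b,\ \mathbf a\neq0,\ \mathbf b\ne0,$$ and $A(\mathbf a,\mathbf b)=0$ otherwise. The linearized 2D Euler operator (linearization, in Fourier variables, of the vorticity equation about the steady state whose only nonzero Fourier modes are $\omega^0_{\mathbf p}=\frac12\Gamma$, $\omega^0_{-\mathbf p}=\frac12\overline\Gamma$) is the operator on the space $\ell^2(\mathbb Z^2)$ of complex sequences $$L:(\omega_{\mathbf k})_{\mathbf k\in\mathbb Z^2}\mapsto\bigl(A(\mathbf p,\mathbf k-\mathbf p)\Gamma\omega_{\mathbf k-\mathbf p}+A(-\mathbf p,\mathbf k+\mathbf p)\overline\Gamma\omega_{\mathbf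 k+\mathbf p}\bigr)_{\mathbf k\in\mathbb Z^2},$$ with domain the set of all $\omega\in\ell^2(\mathbb Z^2)$ such that $L\omega\in\ell^2(\mathbb Z^2)$. Multiplicity means algebraic multiplicity. *)

theory Defs
  imports "HOL-Analysis.Analysis" "HOL-Library.Function_Algebras" "HOL-Library.Extended_Nat"
begin

definition ell2 :: "('a \<Rightarrow> complex) set" where
  "ell2 = {\<omega>. (\<lambda>k. (cmod (\<omega> k))\<^sup>2) summable_on UNIV}"

definition cscale :: "complex \<Rightarrow> ('a \<Rightarrow> complex) \<Rightarrow> ('a \<Rightarrow> complex)" where
  "cscale c \<omega> = (\<lambda>k. c * \<omega> k)"

global_interpretation cseq: vector_space "cscale :: complex \<Rightarrow> ('a \<Rightarrow> complex) \<Rightarrow> _"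
  by unfold_locales (auto simp: cscale_def fun_eq_iff algebra_simps)

text \<open>
  In what follows a pair \<open>D\<close>, \<open>T\<close> is an unbounded operator: \<open>T\<close> is a total function, but only its
  restriction to the domain \<open>D\<close> is meant.
\<close>

definition eigenvalue_on ::
    "('a \<Rightarrow> complex) set \<Rightarrow> (('a \<Rightarrow> complex) \<Rightarrow> ('a \<Rightarrow> complex)) \<Rightarrow> complex \<Rightarrow> bool" where
  "eigenvalue_on D T c \<longleftrightarrow> (\<exists>\<omega>\<in>D. \<omega> \<noteq> 0 \<and> T \<omega> = cscale c \<omega>)"

text \<open>
  The root subspace, i.e. the union over \<open>n\<close> of the kernels of \<open>(T - c)\<^sup>n\<close>. The condition on
  \<open>j < n\<close> says that the vector belongs to the domain of \<open>(T - c)\<^sup>n\<close>.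
\<close>

definition root_subspace ::
    "('a \<Rightarrow> complex) set \<Rightarrow> (('a \<Rightarrow> complex) \<Rightarrow> ('a \<Rightarrow> complex)) \<Rightarrow> complex \<Rightarrow> ('a \<Rightarrow> complex) set" where
  "root_subspace D T c =
    {\<omega>. \<exists>n. (\<forall>j<n. ((\<lambda>\<eta>. T \<eta> - cscale c \<eta>) ^^ j) \<omega> \<in> D) \<and> ((\<lambda>\<eta>. T \<eta> - cscale c \<eta>) ^^ n) \<omega> = 0}"

text \<open>
  The case distinction is needed because \<open>cseq.dim\<close> is \<open>0\<close> on infinite-dimensional subspaces.
\<close>

definition alg_multiplicity ::
    "('a \<Rightarrow> complex) set \<Rightarrow> (('a \<Rightarrow> complex) \<Rightarrow> ('a \<Rightarrow> complex)) \<Rightarrow> complex \<Rightarrow> enat" where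
  "alg_multiplicity D T c =
    (if \<exists>B. finite B \<and> root_subspace D T c \<subseteq> cseq.span B
     then enat (cseq.dim (root_subspace D T c)) else \<infinity>)"

text \<open>The product norm on \<open>real \<times> real\<close> is the Euclidean one.\<close>

definition real_vec :: "int \<times> int \<Rightarrow> real \<times> real" where
  "real_vec a = (real_of_int (fst a), real_of_int (snd a))"

definition euler_coeff :: "int \<times> int \<Rightarrow> int \<times> int \<Rightarrow> real" where
  "euler_coeff a b =
    (if a \<noteq> b \<and> a \<noteq> - b \<and> a \<noteq> 0 \<and> b \<noteq> 0
     then 1 / 2 * (1 / (norm (real_vec a))\<^sup>2 - 1 / (norm (real_vec b))\<^sup>2)
            * real_of_int (fst a * snd b - snd a * fst b)
     else 0)"

definition euler_op ::
    "int \<times> int \<Rightarrow> complex \<Rightarrow> (int \<times> int \<Rightarrow> complex) \<Rightarrow> (int \<times> int \<Rightarrow> complex)" where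
  "euler_op p \<Gamma> \<omega> = (\<lambda>k. complex_of_real (euler_coeff p (k - p)) * \<Gamma> * \<omega> (k - p)
                       + complex_of_real (euler_coeff (- p) (k + p)) * cnj \<Gamma> * \<omega> (k + p))"

definition euler_dom :: "int \<times> int \<Rightarrow> complex \<Rightarrow> (int \<times> int \<Rightarrow> complex) set" where
  "euler_dom p \<Gamma> = {\<omega> \<in> ell2. euler_op p \<Gamma> \<omega> \<in> ell2}"

definition nonimaginary_eigenvalues :: "int \<times> int \<Rightarrow> complex \<Rightarrow> complex set" where
  "nonimaginary_eigenvalues p \<Gamma> =
    {c. eigenvalue_on (euler_dom p \<Gamma>) (euler_op p \<Gamma>) c \<and> Re c \<noteq> 0}"

definition kappa :: "int \<times> int \<Rightarrow> nat" where
  "kappa p = card {q. norm (real_vec q) < norm (real_vec p) \<and>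
                      (\<forall>t::real. real_vec q \<noteq> t *\<^sub>R real_vec p)}"

end

theory Submission
  imports Defs
begin

text \<open>
  Up to a factor that is constant along the lines \<open>k + \<int> p\<close>, the operator is a bounded
  skew-adjoint operator composed with multiplication by
  \<open>weight p k = 1 / \<parallel>p\<parallel>\<^sup>2 - 1 / \<parallel>k\<parallel>\<^sup>2\<close>. Hence it is skew for the indefinite form
  \<open>B x y = (\<Sum>k. weight p k * x k * cnj (y k))\<close>, so the root subspaces of \<open>c\<close> and \<open>d\<close> are
  \<open>B\<close>-orthogonal unless \<open>c + cnj d = 0\<close>, and the sum of those with \<open>Re c > 0\<close> is isotropic. Its
  elements vanish on the line through \<open>p\<close>, and off that line the weight is negative only at
  the \<open>kappa p\<close> points inside the circle. If such an element \<open>z\<close> also vanishes at these points,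
  then \<open>B z z = 0\<close> is a sum of nonnegative terms, so \<open>weight p k * z k = 0\<close> for all \<open>k\<close>, whence
  \<open>z\<close> lies in the kernel of the operator and is \<open>0\<close>. Evaluation at these points is thus
  injective, and the dimension is at most \<open>kappa p\<close>. The same holds for \<open>Re c < 0\<close>.
\<close>

section \<open>Root subspaces\<close>

lemma sum_fun_apply: "(\<Sum>i\<in>I. f i) k = (\<Sum>i\<in>I. f i k)"
  for f :: "'i \<Rightarrow> 'a \<Rightarrow> 'b::comm_monoid_add"
  by (induction I rule: infinite_finite_induct) auto

text \<open>\<open>T\<close> is linear as a total function, so powers of \<open>T - c\<close> are
  linear everywhere, and only membership in \<open>D\<close> has to be tracked separately.\<close>

locale unbounded_operator = T: Vector_Spaces.linear cscale cscale T
  for T :: "('a \<Rightarrow> complex) \<Rightarrow> ('a \<Rightarrow> complex)" +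
  fixes D :: "('a \<Rightarrow> complex) set"
  assumes subspace_dom: "cseq.subspace D"
begin

definition shifted :: "complex \<Rightarrow> ('a \<Rightarrow> complex) \<Rightarrow> ('a \<Rightarrow> complex)" where
  "shifted c x = T x - cscale c x"

abbreviation root :: "complex \<Rightarrow> ('a \<Rightarrow> complex) set" where
  "root \<equiv> root_subspace D T"

lemma shifted_add: "shifted c (x + y) = shifted c x + shifted c y"
  by (simp add: shifted_def T.add cseq.scale_right_distrib)

lemma shifted_scale: "shifted c (cscale a x) = cscale a (shifted c x)"
  by (simp add: shifted_def T.scale cseq.scale_right_diff_distrib cseq.scale_left_commute)

lemma linear_shifted_pow: "Vector_Spaces.linear cscale cscale (shifted c ^^ n)"
proof (induction n)
  case 0
  show ?case unfolding funpow.simps by (rule cseq.linear_id)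
next
  case (Suc n)
  have "Vector_Spaces.linear cscale cscale (shifted c)"
    by unfold_locales (simp_all add: shifted_add shifted_scale)
  from Vector_Spaces.linear_compose[OF Suc this] show ?case
    by (simp add: o_def)
qed

lemmas shifted_pow_add = module_hom.add[OF linear_shifted_pow[unfolded linear_iff_module_hom]]
lemmas shifted_pow_scale = module_hom.scale[OF linear_shifted_pow[unfolded linear_iff_module_hom]]
lemmas shifted_pow_sum = module_hom.sum[OF linear_shifted_pow[unfolded linear_iff_module_hom]]
lemmas shifted_pow_0 = module_hom.zero[OF linear_shifted_pow[unfolded linear_iff_module_hom]]

lemma shifted_pow_eq_0_mono:
  assumes "(shifted c ^^ n) x = 0" "n \<le> m"
  shows "(shifted c ^^ m) x = 0"
proof -
  have "(shifted c ^^ m) x = (shifted c ^^ (m - n)) ((shifted c ^^ n) x)"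
    using assms(2) by (metis comp_apply funpow_add le_add_diff_inverse2)
  then show ?thesis
    using assms(1) by (simp add: shifted_pow_0)
qed

text \<open>Once an iterate is \<open>0\<close>, all later ones are \<open>0\<close>, which lies in
  \<open>D\<close>. So the domain condition may be asked for every \<open>j\<close>, decoupled from
  \<open>n\<close>.\<close>

lemma mem_root_iff:
  "x \<in> root c \<longleftrightarrow> (\<forall>j. (shifted c ^^ j) x \<in> D) \<and> (\<exists>n. (shifted c ^^ n) x = 0)"
proof -
  have eq: "(\<lambda>\<eta>. T \<eta> - cscale c \<eta>) = shifted c"
    by (simp add: shifted_def fun_eq_iff)
  have "(shifted c ^^ j) x \<in> D"
    if "\<forall>i<n. (shifted c ^^ i) x \<in> D" "(shifted c ^^ n) x = 0" for n j
    using that shifted_pow_eq_0_mono[OF that(2), of j] cseq.subspace_0[OF subspace_dom]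
    by (cases "j < n") auto
  then show ?thesis
    unfolding root_subspace_def eq by blast
qed

lemma root_subset_dom: "root c \<subseteq> D"
  using mem_root_iff by (metis eq_id_iff funpow_0 subsetI)

lemma subspace_root: "cseq.subspace (root c)"
proof (rule cseq.subspaceI)
  show "0 \<in> root c"
    using cseq.subspace_0[OF subspace_dom] by (simp add: mem_root_iff shifted_pow_0)
next
  fix x y assume "x \<in> root c" "y \<in> root c"
  then obtain n m where "(shifted c ^^ n) x = 0" "(shifted c ^^ m) y = 0"
    and D: "\<And>j. (shifted c ^^ j) x \<in> D" "\<And>j. (shifted c ^^ j) y \<in> D"
    by (auto simp: mem_root_iff)
  then have "(shifted c ^^ max n m) (x + y) = 0"
    using shifted_pow_eq_0_mono[of _ c x "max n m"] shifted_pow_eq_0_mono[of _ c y "max n m"]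
    by (simp add: shifted_pow_add)
  with D show "x + y \<in> root c"
    by (auto simp: mem_root_iff shifted_pow_add cseq.subspace_add[OF subspace_dom])
next
  fix a x assume "x \<in> root c"
  then show "cscale a x \<in> root c"
    unfolding mem_root_iff shifted_pow_scale
    by (metis cseq.scale_zero_right cseq.subspace_scale[OF subspace_dom])
qed

lemma shifted_mem_root:
  assumes "x \<in> root c"
  shows "shifted c x \<in> root c"
proof -
  have eq: "(shifted c ^^ j) (shifted c x) = (shifted c ^^ Suc j) x" for j
    by (simp add: funpow_swap1)
  obtain n where "(shifted c ^^ n) x = 0"
    using assms by (auto simp: mem_root_iff)
  then have "(shifted c ^^ n) (shifted c x) = 0"
    unfolding eq by (rule shifted_pow_eq_0_mono) simp
  then show ?thesis
    using assms unfolding mem_root_iff eq by blast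
qed

lemma shifted_other: "shifted d x = shifted c x + cscale (c - d) x"
  by (simp add: shifted_def cseq.scale_left_diff_distrib)

text \<open>\<open>T - d\<close> and \<open>T - c\<close> differ by a scalar, so a root subspace is
  invariant under all shifts, not only its own.\<close>

lemma shifted_pow_mem_root:
  assumes "x \<in> root c"
  shows "(shifted d ^^ n) x \<in> root c"
proof (induction n)
  case (Suc n)
  have "shifted d ((shifted d ^^ n) x) \<in> root c"
    unfolding shifted_other[of d "(shifted d ^^ n) x" c]
    by (intro cseq.subspace_add cseq.subspace_scale subspace_root shifted_mem_root Suc)
  then show ?case by simp
qed (use assms in simp)

lemma T_eq_shifted: "T x = shifted c x + cscale c x"
  by (simp add: shifted_def)

lemma T_mem_root: "x \<in> root c \<Longrightarrow> T x \<in> root c"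
  unfolding T_eq_shifted[of x c]
  by (intro cseq.subspace_add cseq.subspace_scale subspace_root shifted_mem_root)

section \<open>Independence of root subspaces\<close>

lemma shifted_inj_on_root:
  assumes "x \<in> root c" "shifted d x = 0" "c \<noteq> d"
  shows "x = 0"
proof -
  \<comment> \<open>On this \<open>x\<close> the map \<open>T - c\<close> acts as the nonzero scalar
    \<open>d - c\<close>; if \<open>x\<close> were nonzero, no power would annihilate it.\<close>
  have x: "shifted c x = cscale (d - c) x"
    using assms(2) shifted_other[of c x d] by simp
  have "(shifted c ^^ n) x = cscale ((d - c) ^ n) x" for n
    by (induction n) (simp_all add: shifted_scale x ac_simps)
  moreover obtain n where "(shifted c ^^ n) x = 0"
    using assms(1) by (auto simp: mem_root_iff)
  ultimately show ?thesis
    using assms(3) by (metis cseq.scale_eq_0_iff eq_iff_diff_eq_0 power_not_zero)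
qed

lemma shifted_pow_inj_on_root:
  assumes "x \<in> root c" "(shifted d ^^ n) x = 0" "c \<noteq> d"
  shows "x = 0"
proof (rule ccontr)
  assume "x \<noteq> 0"
  have "(shifted d ^^ m) x \<noteq> 0" for m
  proof (induction m)
    case (Suc m)
    have "shifted d ((shifted d ^^ m) x) \<noteq> 0"
      using shifted_inj_on_root[OF shifted_pow_mem_root[OF assms(1)] _ assms(3)] Suc by blast
    then show ?case by (metis comp_apply funpow.simps(2))
  qed (metis \<open>x \<noteq> 0\<close> funpow_0)
  then show False
    using assms(2) by blast
qed

text \<open>A power of \<open>T - d\<close> that kills \<open>x d\<close> leaves a shorter vanishing
  sum in the same root subspaces. Injectivity of that power on \<open>root c\<close> for
  \<open>c \<noteq> d\<close> carries the conclusion back to the \<open>x c\<close>.\<close>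

lemma root_sum_eq_0D:
  assumes "finite F" "\<And>c. c \<in> F \<Longrightarrow> x c \<in> root c" "(\<Sum>c\<in>F. x c) = 0"
  shows "\<forall>c\<in>F. x c = 0"
  using assms
proof (induction F arbitrary: x rule: finite_induct)
  case (insert d F)
  obtain n where n: "(shifted d ^^ n) (x d) = 0"
    using insert.prems(1)[of d] by (auto simp: mem_root_iff)
  have "(\<Sum>c\<in>insert d F. (shifted d ^^ n) (x c)) = 0"
    using insert.prems(2) by (simp only: shifted_pow_sum[symmetric] shifted_pow_0)
  then have "(\<Sum>c\<in>F. (shifted d ^^ n) (x c)) = 0"
    using insert.hyps n by simp
  then have "\<forall>c\<in>F. (shifted d ^^ n) (x c) = 0"
    using insert.IH[of "\<lambda>c. (shifted d ^^ n) (x c)"] insert.prems(1) shifted_pow_mem_root by blast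
  then have F: "\<forall>c\<in>F. x c = 0"
    using shifted_pow_inj_on_root insert.prems(1) insert.hyps(2) by (metis insertCI)
  have "x d = (\<Sum>c\<in>insert d F. x c)"
    using F insert.hyps by (metis add.right_neutral sum.insert sum.neutral)
  with F insert.prems(2) show ?case by (metis insertE)
qed blast

text \<open>Regroups a linear combination by eigenvalue, so that facts about sums of root vectors
  apply to a whole span.\<close>

lemma mem_span_UN_root:
  assumes "finite F" "\<And>c. c \<in> F \<Longrightarrow> B c \<subseteq> root c" "x \<in> cseq.span (\<Union>c\<in>F. B c)"
  shows "\<exists>y. (\<forall>c\<in>F. y c \<in> cseq.span (B c)) \<and> x = (\<Sum>c\<in>F. y c)"
  using assms(3)
proof (induction rule: cseq.span_induct_alt)
  case base
  show ?case
    by (intro exI[of _ "\<lambda>_. 0"] conjI ballI) (simp_all only: cseq.span_zero sum.neutral_const)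
next
  case (step a b x)
  then obtain c y where c: "c \<in> F" "b \<in> B c" and y: "\<forall>c\<in>F. y c \<in> cseq.span (B c)" "x = (\<Sum>c\<in>F. y c)"
    by blast
  have "(\<Sum>d\<in>F. if d = c then cscale a b + y d else y d)
      = (\<Sum>d\<in>F. (if d = c then cscale a b else 0) + y d)"
    by (rule sum.cong) auto
  also have "\<dots> = cscale a b + x"
    using c assms(1) y by (simp add: sum.distrib)
  finally show ?case
    using y c by (intro exI[of _ "\<lambda>d. if d = c then cscale a b + y d else y d"])
      (simp_all add: cseq.span_add[OF cseq.span_scale[OF cseq.span_base]])
qed

lemma independent_root_disjoint:
  assumes "cseq.independent B" "B \<subseteq> root c" "C \<subseteq> root d" "c \<noteq> d"
  shows "B \<inter> C = {}"
proof (rule ccontr)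
  assume "\<not> ?thesis"
  then obtain w where w: "w \<in> B" "w \<in> C" by blast
  then obtain n where "(shifted d ^^ n) w = 0"
    using assms(3) mem_root_iff[of w d] by blast
  then have "w = 0"
    using shifted_pow_inj_on_root assms(2,4) w(1) by blast
  then show False
    using assms(1) w(1) cseq.dependent_zero by blast
qed

text \<open>The sets \<open>B c\<close> are disjoint, so a vanishing combination splits by
  \<open>c\<close> into a vanishing sum of root vectors. Each group then vanishes, and independence
  of the single \<open>B c\<close> applies.\<close>

lemma independent_UN_root:
  assumes "finite F" "\<And>c. c \<in> F \<Longrightarrow> B c \<subseteq> root c" "\<And>c. c \<in> F \<Longrightarrow> cseq.independent (B c)"
  shows "cseq.independent (\<Union>c\<in>F. B c)"
  unfolding cseq.independent_explicit_finite_subsets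
proof (intro allI impI ballI)
  fix S u v
  assume S: "S \<subseteq> (\<Union>c\<in>F. B c)" "finite S" "(\<Sum>v\<in>S. cscale (u v) v) = 0" "v \<in> S"
  have disj: "S \<inter> B c \<inter> (S \<inter> B d) = {}" if "c \<in> F" "d \<in> F" "c \<noteq> d" for c d
    using independent_root_disjoint[OF assms(3) assms(2) assms(2)] that by blast
  define x where "x c = (\<Sum>v\<in>S \<inter> B c. cscale (u v) v)" for c
  have "S = (\<Union>c\<in>F. S \<inter> B c)"
    using S(1) by blast
  then have "(\<Sum>c\<in>F. x c) = (\<Sum>v\<in>S. cscale (u v) v)"
    unfolding x_def using assms(1) S(2) disj by (subst sum.UNION_disjoint[symmetric]) auto
  moreover have "x c \<in> root c" if "c \<in> F" for c
    unfolding x_def using assms(2)[OF that]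
    by (intro cseq.subspace_sum cseq.subspace_scale subspace_root) auto
  ultimately have x0: "\<forall>c\<in>F. x c = 0"
    using root_sum_eq_0D[OF assms(1), of x] S(3) by argo
  obtain c where c: "c \<in> F" "v \<in> B c"
    using S by blast
  have "(\<Sum>v\<in>S \<inter> B c. cscale (u v) v) = 0"
    using x0 c(1) unfolding x_def by simp
  then show "u v = 0"
    using assms(3)[OF c(1)] S(2,4) c(2) unfolding cseq.independent_explicit_finite_subsets
    by (meson Int_iff finite_Int inf_le2)
qed

end

section \<open>Counting multiplicities by evaluation at finitely many points\<close>

lemma independent_card_le_evaluations:
  assumes "cseq.independent U" "finite Q"
    and inj: "\<And>x. x \<in> cseq.span U \<Longrightarrow> (\<And>k. k \<in> Q \<Longrightarrow> x k = 0) \<Longrightarrow> x = 0"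
  shows "finite U \<and> card U \<le> card Q"
proof -
  \<comment> \<open>Restriction to \<open>Q\<close>, extended by \<open>0\<close>: it maps into the
    span of the unit vectors at \<open>Q\<close>, and \<open>inj\<close> makes it injective on the
    span of \<open>U\<close>.\<close>
  define E :: "('a \<Rightarrow> complex) \<Rightarrow> 'a \<Rightarrow> complex" where "E x = (\<lambda>k. if k \<in> Q then x k else 0)" for x
  interpret E: Vector_Spaces.linear cscale cscale E
    by unfold_locales (auto simp: E_def fun_eq_iff cscale_def)
  have injE: "inj_on E (cseq.span U)"
  proof (subst E.inj_on_iff_eq_0, rule cseq.subspace_span, intro ballI impI)
    fix x assume "x \<in> cseq.span U" "E x = 0"
    moreover have "x k = 0" if "k \<in> Q" for k
      using fun_cong[OF \<open>E x = 0\<close>, of k] that by (simp add: E_def)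
    ultimately show "x = 0" using inj by blast
  qed
  define e :: "'a \<Rightarrow> 'a \<Rightarrow> complex" where "e q = (\<lambda>k. if k = q then 1 else 0)" for q
  have "E x \<in> cseq.span (e ` Q)" for x
  proof -
    have "E x = (\<Sum>q\<in>Q. cscale (x q) (e q))"
    proof
      fix k
      have "(\<Sum>q\<in>Q. cscale (x q) (e q) k) = (\<Sum>q\<in>Q. if k = q then x q else 0)"
        by (rule sum.cong) (auto simp: cscale_def e_def)
      then show "E x k = (\<Sum>q\<in>Q. cscale (x q) (e q)) k"
        using assms(2) by (simp add: sum_fun_apply E_def)
    qed
    moreover have "\<dots> \<in> cseq.span (e ` Q)"
      by (intro cseq.span_sum cseq.span_scale) (simp add: cseq.span_base)
    ultimately show ?thesis by simp
  qed
  then have "finite (E ` U) \<and> card (E ` U) \<le> card (e ` Q)"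
    using cseq.independent_span_bound[OF finite_imageI[OF assms(2)]
        E.independent_inj_on_image[OF assms(1) injE]] by blast
  moreover have "inj_on E U"
    using inj_on_subset[OF injE cseq.span_superset] .
  ultimately show ?thesis
    using card_image_le[OF assms(2), of e] by (auto simp: finite_image_iff card_image)
qed

text \<open>The union of bases over a finite \<open>F\<close> has at most \<open>card Q\<close>
  elements, uniformly in \<open>F\<close>. Singletons \<open>F\<close> give finite multiplicities;
  as each eigenvalue contributes at least one basis vector, \<open>S\<close> is finite too.\<close>

lemma (in unbounded_operator) sum_alg_multiplicity_le:
  assumes "finite Q" "\<And>c. c \<in> S \<Longrightarrow> eigenvalue_on D T c"
    and inj: "\<And>F x. finite F \<Longrightarrow> F \<subseteq> S \<Longrightarrow> (\<And>c. c \<in> F \<Longrightarrow> x c \<in> root c) \<Longrightarrow>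
      (\<And>k. k \<in> Q \<Longrightarrow> (\<Sum>c\<in>F. x c) k = 0) \<Longrightarrow> (\<Sum>c\<in>F. x c) = 0"
  shows "finite S \<and> (\<Sum>c\<in>S. alg_multiplicity D T c) \<le> enat (card Q)"
proof -
  have "\<exists>B. B \<subseteq> root c \<and> cseq.independent B \<and> root c \<subseteq> cseq.span B \<and> card B = cseq.dim (root c)" for c
    by (meson cseq.basis_exists)
  then obtain B where B: "\<And>c. B c \<subseteq> root c" "\<And>c. cseq.independent (B c)"
      "\<And>c. root c \<subseteq> cseq.span (B c)" "\<And>c. card (B c) = cseq.dim (root c)"
    by metis
  have bound: "finite (\<Union>c\<in>F. B c) \<and> card (\<Union>c\<in>F. B c) \<le> card Q" if F: "finite F" "F \<subseteq> S" for F
  proof (rule independent_card_le_evaluations[OF _ assms(1)])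
    show "cseq.independent (\<Union>c\<in>F. B c)"
      using independent_UN_root F(1) B by blast
    fix x assume "x \<in> cseq.span (\<Union>c\<in>F. B c)" and x0: "\<And>k. k \<in> Q \<Longrightarrow> x k = 0"
    then obtain y where y: "\<forall>c\<in>F. y c \<in> cseq.span (B c)" "x = (\<Sum>c\<in>F. y c)"
      using mem_span_UN_root[OF F(1) B(1)] by blast
    then have "y c \<in> root c" if "c \<in> F" for c
      using that B(1)[of c] cseq.span_minimal[OF _ subspace_root] by blast
    then show "x = 0"
      using inj[OF F, of y] y(2) x0 by blast
  qed
  have finB: "finite (B c)" if "c \<in> S" for c
    using bound[of "{c}"] that by simp
  have disj: "B c \<inter> B d = {}" if "c \<noteq> d" for c d
    using independent_root_disjoint B that by blast
  have sum_le: "(\<Sum>c\<in>F. card (B c)) \<le> card Q" if F: "finite F" "F \<subseteq> S" for F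
    using bound[OF F] F finB disj by (subst card_UN_disjoint[symmetric]) auto
  have "card (B c) \<ge> 1" if c: "c \<in> S" for c
  proof -
    obtain w where w: "w \<in> D" "w \<noteq> 0" "T w = cscale c w"
      using assms(2) \<open>c \<in> S\<close> unfolding eigenvalue_on_def by blast
    have "w \<in> root c"
      unfolding root_subspace_def using w by (auto intro!: exI[of _ 1])
    then have "B c \<noteq> {}"
      using B(3)[of c] w(2) by (auto simp: cseq.span_empty)
    then show ?thesis
      using finB[OF c] by (simp add: Suc_leI card_gt_0_iff)
  qed
  then have "card F \<le> card Q" if "finite F" "F \<subseteq> S" for F
    using sum_le[OF that] sum_mono[of F "\<lambda>_. 1" "\<lambda>c. card (B c)"] that by (auto simp: subset_eq)
  then have "finite S"
    using infinite_arbitrarily_large[of S "Suc (card Q)"] by fastforce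
  moreover have "alg_multiplicity D T c = enat (card (B c))" if "c \<in> S" for c
    using finB[OF that] B(3,4)[of c] unfolding alg_multiplicity_def by auto
  then have "(\<Sum>c\<in>S. alg_multiplicity D T c) = enat (\<Sum>c\<in>S. card (B c))"
    by (simp flip: of_nat_eq_enat)
  ultimately show ?thesis
    using sum_le[of S] by simp
qed

text \<open>At a coordinate where all values of \<open>T\<close> vanish, \<open>T - c\<close> is
  multiplication by \<open>- c\<close>, which is not nilpotent.\<close>

lemma (in unbounded_operator) root_vanishing:
  assumes "x \<in> root c" "c \<noteq> 0" and T0: "\<And>y. T y k = 0"
  shows "x k = 0"
proof -
  have "(shifted c ^^ n) x k = (- c) ^ n * x k" for n
    by (induction n) (auto simp: shifted_def T0 cscale_def)
  moreover obtain n where "(shifted c ^^ n) x = 0"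
    using assms(1) mem_root_iff by blast
  ultimately show ?thesis
    using assms(2) by (metis mult_eq_0_iff neg_equal_0_iff_equal power_not_zero zero_fun_apply)
qed

section \<open>Operators that are skew for a sesquilinear form\<close>

locale skew_operator = unbounded_operator T D
  for T :: "('a \<Rightarrow> complex) \<Rightarrow> ('a \<Rightarrow> complex)" and D +
  fixes B :: "('a \<Rightarrow> complex) \<Rightarrow> ('a \<Rightarrow> complex) \<Rightarrow> complex"
  \<comment> \<open>For a form given by an infinite sum, additivity needs convergence, hence
    \<open>D\<close>; scaling does not.\<close>
  assumes B_add_left: "x \<in> D \<Longrightarrow> y \<in> D \<Longrightarrow> z \<in> D \<Longrightarrow> B (x + y) z = B x z + B y z"
    and B_add_right: "x \<in> D \<Longrightarrow> y \<in> D \<Longrightarrow> z \<in> D \<Longrightarrow> B z (x + y) = B z x + B z y"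
    and B_scale_left: "B (cscale a x) y = a * B x y"
    and B_scale_right: "B x (cscale a y) = cnj a * B x y"
    and B_skew: "x \<in> D \<Longrightarrow> y \<in> D \<Longrightarrow> B (T x) y + B x (T y) = 0"
begin

lemma B_zero_left: "B 0 y = 0" and B_zero_right: "B x 0 = 0"
  using B_scale_left[of 0 0 y] B_scale_right[of x 0 0] by simp_all

text \<open>Writing \<open>T\<close> as \<open>(T - c) + c\<close> on the left and
  \<open>(T - d) + d\<close> on the right turns skewness into
  \<open>(c + cnj d) * B x y = 0\<close>, up to two terms of smaller total nilpotency order, which
  vanish by induction on \<open>n + m\<close>.\<close>

lemma root_orthogonal:
  assumes "x \<in> root c" "y \<in> root d" "c + cnj d \<noteq> 0"
  shows "B x y = 0"
proof -
  have orth: "B x y = 0"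
    if "n + m = s" "x \<in> root c" "y \<in> root d" "(shifted c ^^ n) x = 0" "(shifted d ^^ m) y = 0"
    for s n m x y
    using that
  proof (induction s arbitrary: n m x y rule: less_induct)
    case (less s)
    show ?case
    proof (cases "n = 0 \<or> m = 0")
      case True
      then have "x = 0 \<or> y = 0"
        using less.prems(4,5) by (metis funpow_0)
      then show ?thesis
        using B_zero_left B_zero_right by metis
    next
      case False
      then obtain n' m' where nm: "n = Suc n'" "m = Suc m'"
        by (meson not0_implies_Suc)
      have x': "shifted c x \<in> root c" "(shifted c ^^ n') (shifted c x) = 0"
        using less.prems shifted_mem_root nm by (auto simp only: funpow_Suc_right comp_apply)
      have y': "shifted d y \<in> root d" "(shifted d ^^ m') (shifted d y) = 0"
        using less.prems shifted_mem_root nm by (auto simp only: funpow_Suc_right comp_apply)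
      have 1: "B (shifted c x) y = 0"
        by (rule less.IH[of "n' + m" n' m]) (use x' nm less.prems in \<open>blast | linarith\<close>)+
      have 2: "B x (shifted d y) = 0"
        by (rule less.IH[of "n + m'" n m']) (use y' nm less.prems in \<open>blast | linarith\<close>)+
      have D: "x \<in> D" "y \<in> D" "shifted c x \<in> D" "shifted d y \<in> D"
        using less.prems x'(1) y'(1) root_subset_dom by blast+
      then have D': "cscale c x \<in> D" "cscale d y \<in> D"
        using cseq.subspace_scale[OF subspace_dom] by blast+
      have "B (T x) y = c * B x y" "B x (T y) = cnj d * B x y"
        unfolding T_eq_shifted[of x c] T_eq_shifted[of y d]
          B_add_left[OF D(3) D'(1) D(2)] B_add_right[OF D(4) D'(2) D(1)]
        by (simp_all only: 1 2 B_scale_left B_scale_right add_0)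
      then have "(c + cnj d) * B x y = 0"
        using B_skew[OF D(1,2)] by (simp only: distrib_right)
      then show ?thesis
        using assms(3) mult_eq_0_iff by blast
    qed
  qed
  obtain n m where "(shifted c ^^ n) x = 0" "(shifted d ^^ m) y = 0"
    using assms(1,2) mem_root_iff by meson
  then show ?thesis
    using orth[OF refl assms(1,2)] by simp
qed

lemma B_sum_left:
  assumes "finite F" "\<And>c. c \<in> F \<Longrightarrow> x c \<in> D" "y \<in> D"
  shows "B (\<Sum>c\<in>F. x c) y = (\<Sum>c\<in>F. B (x c) y)"
  using assms(1,2)
proof (induction F rule: finite_induct)
  case (insert d F)
  have "(\<Sum>c\<in>F. x c) \<in> D"
    using insert.prems by (intro cseq.subspace_sum[OF subspace_dom]) blast
  moreover have "B (\<Sum>c\<in>F. x c) y = (\<Sum>c\<in>F. B (x c) y)"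
    using insert by blast
  ultimately show ?case
    using insert.prems insert.hyps B_add_left[of "x d" "\<Sum>c\<in>F. x c" y] assms(3)
    by (simp only: sum.insert insertI1 insertI2 simp_thms)
qed (simp only: sum.empty B_zero_left)

lemma B_sum_right:
  assumes "finite F" "\<And>c. c \<in> F \<Longrightarrow> x c \<in> D" "y \<in> D"
  shows "B y (\<Sum>c\<in>F. x c) = (\<Sum>c\<in>F. B y (x c))"
  using assms(1,2)
proof (induction F rule: finite_induct)
  case (insert d F)
  have "(\<Sum>c\<in>F. x c) \<in> D"
    using insert.prems by (intro cseq.subspace_sum[OF subspace_dom]) blast
  moreover have "B y (\<Sum>c\<in>F. x c) = (\<Sum>c\<in>F. B y (x c))"
    using insert by blast
  ultimately show ?case
    using insert.prems insert.hyps B_add_right[of "x d" "\<Sum>c\<in>F. x c" y] assms(3)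
    by (simp only: sum.insert insertI1 insertI2 simp_thms)
qed (simp only: sum.empty B_zero_right)

text \<open>The third hypothesis includes \<open>c = d\<close>, so the diagonal terms vanish along
  with the mixed ones.\<close>

lemma root_sum_isotropic:
  assumes "finite F" "\<And>c. c \<in> F \<Longrightarrow> x c \<in> root c" "\<And>c d. c \<in> F \<Longrightarrow> d \<in> F \<Longrightarrow> c + cnj d \<noteq> 0"
  shows "B (\<Sum>c\<in>F. x c) (\<Sum>c\<in>F. x c) = 0"
proof -
  have D: "x c \<in> D" if "c \<in> F" for c
    using assms(2)[OF that] root_subset_dom by blast
  then have "(\<Sum>c\<in>F. x c) \<in> D"
    by (intro cseq.subspace_sum[OF subspace_dom])
  then have "B (\<Sum>c\<in>F. x c) (\<Sum>c\<in>F. x c) = (\<Sum>c\<in>F. B (x c) (\<Sum>d\<in>F. x d))"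
    by (intro B_sum_left assms(1) D)
  also have "\<dots> = (\<Sum>c\<in>F. \<Sum>d\<in>F. B (x c) (x d))"
    by (intro sum.cong refl B_sum_right assms(1) D)
  also have "\<dots> = 0"
    by (intro sum.neutral ballI root_orthogonal[OF assms(2) assms(2) assms(3)])
  finally show ?thesis .
qed

end

section \<open>Square-summable sequences\<close>

lemma ell2_iff_abs_summable: "x \<in> ell2 \<longleftrightarrow> (\<lambda>k. cmod (x k * x k)) summable_on UNIV"
  by (simp add: ell2_def norm_mult power2_eq_square)

lemma ell2_abs_summable_mult:
  assumes "x \<in> ell2" "y \<in> ell2"
  shows "(\<lambda>k. cmod (x k * y k)) summable_on A"
proof -
  have "(\<lambda>k. cmod (x k * y k)) summable_on UNIV"
    using assms unfolding ell2_iff_abs_summable by (rule abs_summable_product)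
  then show ?thesis
    by (rule summable_on_subset_banach) simp
qed

lemma ell2_cnj: "x \<in> ell2 \<Longrightarrow> (\<lambda>k. cnj (x k)) \<in> ell2"
  by (simp add: ell2_def)

lemma ell2_bounded_mult:
  assumes "x \<in> ell2" "\<And>k. cmod (w k) \<le> C"
  shows "(\<lambda>k. w k * x k) \<in> ell2"
proof -
  have "(\<lambda>k. C\<^sup>2 * (cmod (x k))\<^sup>2) summable_on UNIV"
    using assms(1) by (intro summable_on_cmult_right) (simp add: ell2_def)
  then show ?thesis
    unfolding ell2_def mem_Collect_eq
    by (rule summable_on_comparison_test)
      (auto simp: norm_mult power_mult_distrib intro!: mult_right_mono power_mono assms(2))
qed

lemma ell2_translate:
  fixes x :: "'a::ab_group_add \<Rightarrow> complex"
  assumes "x \<in> ell2"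
  shows "(\<lambda>k. x (k + p)) \<in> ell2"
proof -
  have "bij (\<lambda>k. k + p)"
    by (rule bijI') (auto intro: exI[of _ "_ - p"] simp: algebra_simps)
  then show ?thesis
    using assms summable_on_reindex_bij_betw[of "\<lambda>k. k + p" UNIV UNIV "\<lambda>k. (cmod (x k))\<^sup>2"]
    by (simp add: ell2_def)
qed

lemma subspace_ell2: "cseq.subspace ell2"
proof (rule cseq.subspaceI)
  show "0 \<in> ell2" by (simp add: ell2_def)
next
  fix x y :: "'a \<Rightarrow> complex" assume "x \<in> ell2" "y \<in> ell2"
  then have "(\<lambda>k. 2 * (cmod (x k))\<^sup>2 + 2 * (cmod (y k))\<^sup>2) summable_on UNIV"
    by (intro summable_on_add summable_on_cmult_right) (simp_all add: ell2_def)
  then show "x + y \<in> ell2"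
    unfolding ell2_def mem_Collect_eq
  proof (rule summable_on_comparison_test)
    fix k
    have "(cmod (x k + y k))\<^sup>2 \<le> (cmod (x k) + cmod (y k))\<^sup>2"
      by (intro power_mono norm_triangle_ineq) simp
    also have "\<dots> \<le> 2 * (cmod (x k))\<^sup>2 + 2 * (cmod (y k))\<^sup>2"
      using zero_le_power2[of "cmod (x k) - cmod (y k)"] by (simp add: power2_eq_square algebra_simps)
    finally show "(cmod ((x + y) k))\<^sup>2 \<le> 2 * (cmod (x k))\<^sup>2 + 2 * (cmod (y k))\<^sup>2"
      by simp
  qed simp
next
  fix a and x :: "'a \<Rightarrow> complex" assume "x \<in> ell2"
  then show "cscale a x \<in> ell2"
    unfolding cscale_def by (rule ell2_bounded_mult[OF _ order_refl])
qed

text \<open>Fubini for the partition of the index set into the fibres of \<open>g\<close>.\<close>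

lemma infsum_eq_0_fibrewise:
  fixes f :: "'a \<Rightarrow> 'b::banach" and g :: "'a \<Rightarrow> 'c"
  assumes "f summable_on UNIV" "\<And>j. infsum f {k. g k = j} = 0"
  shows "infsum f UNIV = 0"
proof -
  define S where "S = Sigma UNIV (\<lambda>j. {k. g k = j})"
  have bij: "bij_betw snd S UNIV"
    by (auto simp: bij_betw_def inj_on_def S_def image_iff)
  have "(\<lambda>jk. f (snd jk)) summable_on S"
    using summable_on_reindex_bij_betw[OF bij, of f] assms(1) by simp
  then have "infsum (\<lambda>jk. f (snd jk)) S = infsum (\<lambda>j. infsum f {k. g k = j}) UNIV"
    unfolding S_def by (subst infsum_Sigma_banach[symmetric]) auto
  then show ?thesis
    using infsum_reindex_bij_betw[OF bij, of f] assms(2) by simp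
qed

section \<open>The linearized Euler operator\<close>

text \<open>The determinant of the two vectors. It vanishes on parallel ones, so
  \<open>cross p\<close> is unchanged by translation along \<open>p\<close> and factors out of both
  coefficients of the operator.\<close>

definition cross :: "int \<times> int \<Rightarrow> int \<times> int \<Rightarrow> int" where
  "cross a b = fst a * snd b - snd a * fst b"

text \<open>The junk value at \<open>k = 0\<close> is harmless, because \<open>cross p 0 = 0\<close>.\<close>

definition weight :: "int \<times> int \<Rightarrow> int \<times> int \<Rightarrow> real" where
  "weight p k = 1 / (norm (real_vec p))\<^sup>2 - 1 / (norm (real_vec k))\<^sup>2"

text \<open>On the diagonal this is, up to a constant factor, enstrophy divided by the squared norm
  of \<open>p\<close>, minus energy: the energy-Casimir quadratic form of the steady state.\<close>

definition energy_form ::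
    "int \<times> int \<Rightarrow> (int \<times> int \<Rightarrow> complex) \<Rightarrow> (int \<times> int \<Rightarrow> complex) \<Rightarrow> complex" where
  "energy_form p x y = (\<Sum>\<^sub>\<infinity>k. of_real (weight p k) * x k * cnj (y k))"

text \<open>The exceptional cases of \<open>euler_coeff\<close> all force
  \<open>cross p k = 0\<close>, so one formula covers every \<open>k\<close>.\<close>

lemma euler_coeff_diff: "euler_coeff p (k - p) = cross p k / 2 * weight p (k - p)"
proof (cases "p \<noteq> k - p \<and> p \<noteq> - (k - p) \<and> p \<noteq> 0 \<and> k - p \<noteq> 0")
  case True
  have "fst p * snd (k - p) - snd p * fst (k - p) = cross p k"
    by (simp add: cross_def algebra_simps)
  then show ?thesis
    using True by (simp only: euler_coeff_def weight_def) simp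
next
  case False
  then have "k = p + p \<or> k = 0 \<or> p = 0 \<or> k = p"
    by (auto simp: algebra_simps)
  then have "cross p k = 0"
    by (auto simp: cross_def algebra_simps)
  then show ?thesis
    using False by (auto simp: euler_coeff_def)
qed

lemma euler_coeff_add: "euler_coeff (- p) (k + p) = - (cross p k / 2 * weight p (k + p))"
proof -
  have "real_vec (- p) = - real_vec p"
    by (simp add: real_vec_def)
  then have "weight (- p) = weight p"
    by (simp add: weight_def fun_eq_iff)
  moreover have "cross (- p) k = - cross p k"
    by (simp add: cross_def)
  ultimately show ?thesis
    using euler_coeff_diff[of "- p" k] by simp
qed

lemma euler_op_eq:
  "euler_op p \<Gamma> x k = complex_of_real (cross p k / 2) *
    (\<Gamma> * (of_real (weight p (k - p)) * x (k - p)) - cnj \<Gamma> * (of_real (weight p (k + p)) * x (k + p)))"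
  unfolding euler_op_def euler_coeff_diff euler_coeff_add by (simp add: algebra_simps)

lemma linear_euler_op: "Vector_Spaces.linear cscale cscale (euler_op p \<Gamma>)"
  by unfold_locales (auto simp: euler_op_def cscale_def fun_eq_iff algebra_simps)

lemma subspace_euler_dom: "cseq.subspace (euler_dom p \<Gamma>)"
proof -
  interpret L: Vector_Spaces.linear cscale cscale "euler_op p \<Gamma>"
    by (rule linear_euler_op)
  have "euler_dom p \<Gamma> = ell2 \<inter> euler_op p \<Gamma> -` ell2"
    by (auto simp: euler_dom_def)
  then show ?thesis
    by (simp only: cseq.subspace_inter subspace_ell2 L.subspace_vimage)
qed

lemma norm_real_vec_ge_1:
  assumes "k \<noteq> 0"
  shows "norm (real_vec k) \<ge> 1"
proof -
  have "(fst k)\<^sup>2 + (snd k)\<^sup>2 > 0"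
    using assms by (simp add: sum_power2_gt_zero_iff prod_eq_iff)
  then have "(1::int) \<le> (fst k)\<^sup>2 + (snd k)\<^sup>2" by linarith
  then have "real_of_int 1 \<le> real_of_int ((fst k)\<^sup>2 + (snd k)\<^sup>2)"
    by (simp only: of_int_le_iff)
  then show ?thesis
    by (simp add: real_vec_def norm_Pair)
qed

text \<open>Nonzero integer vectors have norm at least \<open>1\<close>, and
  \<open>1 / 0 = 0\<close>; hence both reciprocals lie between \<open>0\<close> and
  \<open>1\<close>.\<close>

lemma abs_weight_le: "\<bar>weight p k\<bar> \<le> 1"
proof -
  have inv: "0 \<le> 1 / (norm (real_vec k))\<^sup>2 \<and> 1 / (norm (real_vec k))\<^sup>2 \<le> 1" for k
  proof (cases "k = 0")
    case True
    then show ?thesis by (simp add: real_vec_def flip: zero_prod_def)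
  next
    case False
    then show ?thesis
      using power_mono[OF norm_real_vec_ge_1[OF False], of 2] by (simp add: divide_le_eq)
  qed
  show ?thesis
    unfolding weight_def using inv[of p] inv[of k] by linarith
qed

lemma ell2_weight_mult: "x \<in> ell2 \<Longrightarrow> (\<lambda>k. of_real (weight p k) * x k) \<in> ell2"
  by (rule ell2_bounded_mult[where C = 1]) (simp_all add: abs_weight_le)

lemma energy_form_summable:
  assumes "x \<in> ell2" "y \<in> ell2"
  shows "(\<lambda>k. of_real (weight p k) * x k * cnj (y k)) summable_on A"
  using ell2_abs_summable_mult[OF ell2_weight_mult[OF assms(1)] ell2_cnj[OF assms(2)]]
  by (rule abs_summable_summable)

text \<open>
  The factor \<open>cross p k\<close> is unbounded, but constant on each line \<open>k + \<int> p\<close>: on such a line the sum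
  telescopes with summable terms, and the double series is then summed line by line.
\<close>

lemma energy_form_skew:
  assumes "x \<in> euler_dom p \<Gamma>" "y \<in> euler_dom p \<Gamma>"
  shows "energy_form p (euler_op p \<Gamma> x) y + energy_form p x (euler_op p \<Gamma> y) = 0"
proof -
  define L where "L = euler_op p \<Gamma>"
  have ell2: "x \<in> ell2" "y \<in> ell2" "L x \<in> ell2" "L y \<in> ell2"
    using assms by (auto simp: euler_dom_def L_def)
  define u where "u k = of_real (weight p k) * x k" for k
  define v where "v k = of_real (weight p k) * y k" for k
  \<comment> \<open>\<open>G k\<close> collects the interaction between the neighbours
    \<open>k - p\<close> and \<open>k\<close>; it is the quantity that telescopes.\<close>
  define G where "G k = \<Gamma> * (u (k - p) * cnj (v k)) + cnj \<Gamma> * (u k * cnj (v (k - p)))" for k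
  define f where "f k = of_real (weight p k) * L x k * cnj (y k)
    + of_real (weight p k) * x k * cnj (L y k)" for k
  have uv: "u \<in> ell2" "v \<in> ell2"
    unfolding u_def v_def by (intro ell2_weight_mult ell2)+
  then have shift: "(\<lambda>k. u (k - p)) \<in> ell2" "(\<lambda>k. v (k - p)) \<in> ell2"
    using ell2_translate[of u "- p"] ell2_translate[of v "- p"] by simp_all
  have G: "G summable_on A" for A
    unfolding G_def
    by (intro summable_on_add summable_on_cmult_right
        ell2_abs_summable_mult[OF shift(1) ell2_cnj[OF uv(2)], THEN abs_summable_summable]
        ell2_abs_summable_mult[OF uv(1) ell2_cnj[OF shift(2)], THEN abs_summable_summable])
  have f: "f summable_on UNIV"
    unfolding f_def by (intro summable_on_add energy_form_summable ell2)
  have cross_add: "cross p (k + p) = cross p k" for k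
    by (simp add: cross_def algebra_simps)
  have f_eq: "f k = complex_of_real (cross p k / 2) * (G k - G (k + p))" for k
  proof -
    have "f k = L x k * cnj (v k) + u k * cnj (L y k)"
      unfolding f_def u_def v_def by (simp add: mult_ac)
    also have "L x k = complex_of_real (cross p k / 2) * (\<Gamma> * u (k - p) - cnj \<Gamma> * u (k + p))"
      unfolding L_def euler_op_eq u_def ..
    also have "L y k = complex_of_real (cross p k / 2) * (\<Gamma> * v (k - p) - cnj \<Gamma> * v (k + p))"
      unfolding L_def euler_op_eq v_def ..
    finally show ?thesis
      by (simp add: G_def algebra_simps)
  qed
  have "infsum f {k. cross p k = j} = 0" for j
  proof -
    have bij: "bij_betw (\<lambda>k. k + p) {k. cross p k = j} {k. cross p k = j}"
      by (rule bij_betw_byWitness[where f' = "\<lambda>k. k - p"]) (use cross_add cross_add[of "_ - p"] in auto)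
    \<comment> \<open>Translation by \<open>p\<close> permutes the level set of
      \<open>cross p\<close>, so \<open>G\<close> and its translate have the same sum there.\<close>
    have "(G has_sum infsum G {k. cross p k = j}) {k. cross p k = j}"
      using G by (rule has_sum_infsum)
    moreover from this have "((\<lambda>k. G (k + p)) has_sum infsum G {k. cross p k = j}) {k. cross p k = j}"
      by (simp only: has_sum_reindex_bij_betw[OF bij])
    then have "((\<lambda>k. - G (k + p)) has_sum - infsum G {k. cross p k = j}) {k. cross p k = j}"
      by (simp add: has_sum_uminus)
    ultimately have "((\<lambda>k. G k - G (k + p)) has_sum 0) {k. cross p k = j}"
      using has_sum_add by fastforce
    then have "((\<lambda>k. complex_of_real (j / 2) * (G k - G (k + p))) has_sum 0) {k. cross p k = j}"
      using has_sum_cmult_right[where c = "complex_of_real (j / 2)"] by fastforce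
    then have "(f has_sum 0) {k. cross p k = j}"
      by (rule has_sum_cong[THEN iffD1, rotated]) (simp add: f_eq)
    then show ?thesis by (rule infsumI)
  qed
  then have "infsum f UNIV = 0"
    by (rule infsum_eq_0_fibrewise[OF f])
  then show ?thesis
    unfolding energy_form_def f_def L_def[symmetric]
    by (subst infsum_add[symmetric]) (auto intro!: energy_form_summable ell2)
qed

lemma skew_operator_euler: "skew_operator (euler_op p \<Gamma>) (euler_dom p \<Gamma>) (energy_form p)"
proof -
  interpret L: Vector_Spaces.linear cscale cscale "euler_op p \<Gamma>"
    by (rule linear_euler_op)
  have ell2: "x \<in> ell2" if "x \<in> euler_dom p \<Gamma>" for x
    using that by (simp add: euler_dom_def)
  show ?thesis
  proof
    show "cseq.subspace (euler_dom p \<Gamma>)"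
      by (rule subspace_euler_dom)
  next
    fix x y z assume "x \<in> euler_dom p \<Gamma>" "y \<in> euler_dom p \<Gamma>" "z \<in> euler_dom p \<Gamma>"
    note ell2 = this[THEN ell2]
    show "energy_form p (x + y) z = energy_form p x z + energy_form p y z"
      unfolding energy_form_def infsum_add[OF energy_form_summable[OF ell2(1,3)]
          energy_form_summable[OF ell2(2,3)], symmetric]
      by (simp add: algebra_simps)
    show "energy_form p z (x + y) = energy_form p z x + energy_form p z y"
      unfolding energy_form_def infsum_add[OF energy_form_summable[OF ell2(3,1)]
          energy_form_summable[OF ell2(3,2)], symmetric]
      by (simp add: algebra_simps)
  next
    \<comment> \<open>Scalars commute with infinite sums even without summability, as the default
      value is \<open>0\<close>.\<close>
    fix a x y
    show "energy_form p (cscale a x) y = a * energy_form p x y"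
      unfolding energy_form_def cscale_def
      by (subst infsum_cmult_right'[symmetric]) (simp add: mult_ac)
    show "energy_form p x (cscale a y) = cnj a * energy_form p x y"
      unfolding energy_form_def cscale_def
      by (subst infsum_cmult_right'[symmetric]) (simp add: mult_ac)
  qed (rule energy_form_skew)
qed

section \<open>Signs of the weight and the count in a half plane\<close>

lemma finite_norm_real_vec_less: "finite {q. norm (real_vec q) < r}"
proof (rule finite_subset)
  show "{q. norm (real_vec q) < r} \<subseteq> {- \<lceil>r\<rceil>..\<lceil>r\<rceil>} \<times> {- \<lceil>r\<rceil>..\<lceil>r\<rceil>}"
  proof
    fix q assume "q \<in> {q. norm (real_vec q) < r}"
    then have "\<bar>real_of_int (fst q)\<bar> < r" "\<bar>real_of_int (snd q)\<bar> < r"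
      using norm_fst_le[of "real_of_int (fst q)" "real_of_int (snd q)"]
        norm_snd_le[of "real_of_int (snd q)" "real_of_int (fst q)"]
      by (auto simp: real_vec_def)
    then have "\<bar>fst q\<bar> \<le> \<lceil>r\<rceil>" "\<bar>snd q\<bar> \<le> \<lceil>r\<rceil>"
      by linarith+
    then show "q \<in> {- \<lceil>r\<rceil>..\<lceil>r\<rceil>} \<times> {- \<lceil>r\<rceil>..\<lceil>r\<rceil>}"
      by (cases q) auto
  qed
qed simp

lemma weight_nonneg:
  assumes "p \<noteq> 0" "norm (real_vec p) \<le> norm (real_vec k)"
  shows "weight p k \<ge> 0"
proof -
  have "0 < norm (real_vec p)"
    using norm_real_vec_ge_1[OF assms(1)] by linarith
  then show ?thesis
    unfolding weight_def using assms(2) by (simp add: frac_le power_mono)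
qed

text \<open>Points inside the circle that \<open>kappa\<close> leaves out lie on the line through
  \<open>p\<close>; there the values of the operator vanish, and so do root vectors for nonzero
  \<open>c\<close>.\<close>

lemma cross_eq_0_of_scaleR:
  assumes "real_vec k = t *\<^sub>R real_vec p"
  shows "cross p k = 0"
proof -
  have "real_of_int (cross p k) = 0"
    using assms by (auto simp: real_vec_def cross_def)
  then show ?thesis by simp
qed

text \<open>
  The sign \<open>s\<close> selects a half plane. No two eigenvalues in it satisfy \<open>c + cnj d = 0\<close>, so the sum of
  their root subspaces is isotropic for the energy form, which has \<open>kappa p\<close> negative squares there.
\<close>

lemma half_plane_multiplicity_le:
  fixes \<Gamma> :: complex and s :: real
  assumes "p \<noteq> 0"
  defines "S \<equiv> {c \<in> nonimaginary_eigenvalues p \<Gamma>. s * Re c > 0}"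
  shows "finite S \<and>
    (\<Sum>c\<in>S. alg_multiplicity (euler_dom p \<Gamma>) (euler_op p \<Gamma>) c) \<le> enat (kappa p)"
proof -
  interpret skew_operator "euler_op p \<Gamma>" "euler_dom p \<Gamma>" "energy_form p"
    by (rule skew_operator_euler)
  define Q where "Q = {q. norm (real_vec q) < norm (real_vec p) \<and>
    (\<forall>t::real. real_vec q \<noteq> t *\<^sub>R real_vec p)}"
  have "finite Q"
    unfolding Q_def using finite_norm_real_vec_less by simp
  moreover have "eigenvalue_on (euler_dom p \<Gamma>) (euler_op p \<Gamma>) c" if "c \<in> S" for c
    using that by (simp add: S_def nonimaginary_eigenvalues_def)
  moreover have "(\<Sum>c\<in>F. x c) = 0"
    if F: "finite F" "F \<subseteq> S" and x: "\<And>c. c \<in> F \<Longrightarrow> x c \<in> root c"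
      and xQ: "\<And>k. k \<in> Q \<Longrightarrow> (\<Sum>c\<in>F. x c) k = 0" for F x
  proof -
    define z where "z = (\<Sum>c\<in>F. x c)"
    have nz: "c \<noteq> 0" "c + cnj d \<noteq> 0" if "c \<in> F" "d \<in> F" for c d
    proof -
      have pos: "s * Re c > 0" "s * Re d > 0"
        using that F(2) by (auto simp: S_def)
      then have "s * Re (c + cnj d) > 0"
        by (simp add: distrib_left)
      with pos show "c \<noteq> 0" "c + cnj d \<noteq> 0"
        by (metis less_irrefl mult_zero_right zero_complex.sel(1))+
    qed
    have "z \<in> euler_dom p \<Gamma>"
      unfolding z_def using x root_subset_dom by (intro cseq.subspace_sum subspace_dom) blast
    then have z: "z \<in> ell2"
      by (simp add: euler_dom_def)
    \<comment> \<open>The weight can be negative only inside the circle; there \<open>z\<close> is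
      \<open>0\<close>, by \<open>root_vanishing\<close> on the line through \<open>p\<close> and by
      assumption on \<open>Q\<close>.\<close>
    have weight_pos: "weight p k * (cmod (z k))\<^sup>2 \<ge> 0" for k
    proof (cases "cross p k = 0 \<or> k \<in> Q")
      case True
      moreover have "z k = 0" if "cross p k = 0"
      proof -
        have "x c k = 0" if "c \<in> F" for c
          using root_vanishing[OF x[OF that] nz(1)[OF that that]] \<open>cross p k = 0\<close>
          by (simp add: euler_op_eq)
        then show ?thesis
          by (simp add: z_def sum_fun_apply)
      qed
      ultimately have "z k = 0"
        using xQ unfolding z_def by blast
      then show ?thesis by simp
    next
      case False
      then have "norm (real_vec p) \<le> norm (real_vec k)"
        using cross_eq_0_of_scaleR[of k _ p] unfolding Q_def by force
      then show ?thesis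
        using weight_nonneg[OF assms(1)] by simp
    qed
    have eq: "of_real (weight p k) * z k * cnj (z k) = complex_of_real (weight p k * (cmod (z k))\<^sup>2)" for k
      by (simp add: complex_norm_square[symmetric] mult.assoc del: of_real_power)
    have "(\<Sum>\<^sub>\<infinity>k. complex_of_real (weight p k * (cmod (z k))\<^sup>2)) = 0"
      using root_sum_isotropic[OF F(1) x nz(2)] unfolding z_def[symmetric] energy_form_def eq by blast
    moreover have summable: "(\<lambda>k. complex_of_real (weight p k * (cmod (z k))\<^sup>2)) summable_on UNIV"
      unfolding eq[symmetric] by (rule energy_form_summable[OF z z])
    ultimately have "complex_of_real (weight p k * (cmod (z k))\<^sup>2) = 0" for k
      using nonneg_infsum_le_0D_complex[OF _ summable, of k] weight_pos
      by (simp add: less_eq_complex_def)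
    then have "of_real (weight p k) * z k = 0" for k
      by auto
    \<comment> \<open>On the circle itself the weight is \<open>0\<close> and \<open>z\<close> need
      not be, so \<open>z = 0\<close> does not follow yet; but the operator sees \<open>z\<close>
      only through \<open>weight p k * z k\<close>.\<close>
    then have "euler_op p \<Gamma> z = 0"
      unfolding fun_eq_iff euler_op_eq by (simp only: mult_zero_right diff_zero zero_fun_apply simp_thms)
    then have "(\<Sum>c\<in>F. euler_op p \<Gamma> (x c)) = 0"
      unfolding z_def by (simp only: T.sum)
    \<comment> \<open>The images stay in their root subspaces, so each is \<open>0\<close>
      separately; then \<open>x c\<close> lies in the kernel of the operator, which meets
      \<open>root c\<close> trivially because \<open>c \<noteq> 0\<close>.\<close>
    then have "euler_op p \<Gamma> (x c) = 0" if "c \<in> F" for c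
      using root_sum_eq_0D[OF F(1), of "\<lambda>c. euler_op p \<Gamma> (x c)"] T_mem_root x that by blast
    then have "x c = 0" if "c \<in> F" for c
      using shifted_inj_on_root[OF x[OF that], of 0] nz(1)[OF that that] that
      by (simp add: shifted_def)
    then show ?thesis by simp
  qed
  ultimately have "finite S \<and>
      (\<Sum>c\<in>S. alg_multiplicity (euler_dom p \<Gamma>) (euler_op p \<Gamma>) c) \<le> enat (card Q)"
    by (rule sum_alg_multiplicity_le)
  then show ?thesis
    by (simp add: kappa_def Q_def)
qed

text \<open>Finiteness is stated as well because a sum over an infinite set is \<open>0\<close> by
  convention, so the inequality alone would not bound the count.\<close>

theorem theorem6:
  fixes p :: "int \<times> int" and \<Gamma> :: complex
  assumes "p \<noteq> 0" and "\<Gamma> \<noteq> 0"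
  shows "finite (nonimaginary_eigenvalues p \<Gamma>) \<and>
    (\<Sum>c\<in>nonimaginary_eigenvalues p \<Gamma>. alg_multiplicity (euler_dom p \<Gamma>) (euler_op p \<Gamma>) c)
      \<le> enat (2 * kappa p)"
proof -
  define N where "N s = {c \<in> nonimaginary_eigenvalues p \<Gamma>. s * Re c > 0}" for s :: real
  define \<mu> where "\<mu> = alg_multiplicity (euler_dom p \<Gamma>) (euler_op p \<Gamma>)"
  have N: "finite (N s)" "(\<Sum>c\<in>N s. \<mu> c) \<le> enat (kappa p)" for s
    using half_plane_multiplicity_le[OF assms(1), of \<Gamma> s] by (simp_all add: N_def \<mu>_def)
  have split: "nonimaginary_eigenvalues p \<Gamma> = N 1 \<union> N (- 1)" "N 1 \<inter> N (- 1) = {}"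
    by (auto simp: N_def nonimaginary_eigenvalues_def)
  then have "(\<Sum>c\<in>nonimaginary_eigenvalues p \<Gamma>. \<mu> c) = (\<Sum>c\<in>N 1. \<mu> c) + (\<Sum>c\<in>N (- 1). \<mu> c)"
    using N(1) by (simp add: sum.union_disjoint)
  also have "\<dots> \<le> enat (kappa p) + enat (kappa p)"
    by (intro add_mono N)
  finally show ?thesis
    using N(1) split(1) by (simp add: \<mu>_def mult_2)
qed

end
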